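(* Let $(G_t)_{t\ge 0}$ be a family of real-valued functions on $\mathbb{R}$, locally of bounded variation, such that for every $t\ge 0$ the function $G_t$ is non-decreasing and $\lim_{x\to-\infty}G_t(x)=0$. Assume that for every $t$ the bilateral Laplace--Stieltjes transform $\hat G_t(s)=\int_{-\infty}^{\infty}e^{-sx}\,\mathrm{d}G_t(x)$ exists for $s\in(0,\xi_t)$, for some $\xi_t>0$. Suppose that there exist $\alpha\ge 0$, a family $(L_t)_{t\ge 0}\in\mathcal{L}_\alpha^+$ and a family $(s_t)_{t\ge 0}$ with $s_t>0$ for all $t$, $s_t=o(\xi_t)$ and $s_t\to 0$ as $t\to\infty$, such that for every $\lambda>0$ $$\lim_{t\to\infty}\ \sup_{s\in(0,\lambda s_t]}\left|\frac{\hat G_t(s)}{\Gamma(\alpha+1)\,L_t(1/s)\,s^{-\alpha}}-1\right|=0 .$$ Then, setting $x_t:=1/s_t$, $$\lim_{t\to\infty}\ \sup_{x\ge x_t}\left|\frac{G_t(x)}{L_t(x)\,x^{\alpha}}-1\right|=0 .$$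
   Context: A function $\ell$ is slowly varying at infinity if $\lim_{x\to\infty}\ell(\Lambda x)/\ell(x)=1$ for every $\Lambda>0$. The class $\mathcal{L}$: a family $(L_t)_{t\ge0}$ of functions slowly varying at infinity belongs to $\mathcal{L}$ if (a) there exist $x_0,t_0$ such that $L_t(x)>0$ for all $t\ge t_0$ and $x\ge x_0$; and (b) for every $\Lambda>0$ and $\eta>0$ there exist $\bar x=\bar x(\eta,\Lambda)$ and $\bar t=\bar t(\eta,\Lambda)$, with $\bar t\ge t_0$ and $\min\{\bar x,\Lambda\bar x\}\ge x_0$, such that $\sup_{x\ge\bar x}\left|\frac{L_t(\Lambda x)}{L_t(x)}-1\right|<\eta$ for all $t\ge\bar t$. The class $\mathcal{L}_\alpha^+\subseteq\mathcal{L}$: the families $(L_t)_{t\ge0}\in\mathcal{L}$ for which, in addition, $x\mapsto x^\alpha L_t(x)$ is non-decreasing eventually in $x$, independently of $t$ (i.e. on a half-line $[x_1,\infty)$ with $x_1$ not depending on $t$). *)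

theory Defs
  imports "HOL-Analysis.Analysis" "HOL-Library.Landau_Symbols"
begin

definition slowly_varying :: "(real \<Rightarrow> real) \<Rightarrow> bool" where
  "slowly_varying l \<longleftrightarrow> (\<forall>\<Lambda>>0. ((\<lambda>x. l (\<Lambda> * x) / l x) \<longlongrightarrow> 1) at_top)"

text \<open>
  Families indexed by \<open>t \<ge> 0\<close> are functions of a real \<open>t\<close> whose values at negative \<open>t\<close>
  are irrelevant. Likewise the functions \<open>L t\<close> matter only on the positive half-line, so the
  thresholds \<open>x0\<close> and \<open>x1\<close> below are taken positive; as they are existentially quantified and
  may always be enlarged, this is no restriction.

  Suprema are taken in the extended reals, because a supremum of an unbounded set of reals is
  an unspecified number.
\<close>

definition class_L :: "(real \<Rightarrow> real \<Rightarrow> real) set" where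
  "class_L = {L. (\<forall>t\<ge>0. slowly_varying (L t)) \<and>
     (\<exists>x0>0. \<exists>t0\<ge>0.
        (\<forall>t\<ge>t0. \<forall>x\<ge>x0. L t x > 0) \<and>
        (\<forall>\<Lambda>>0. \<forall>\<eta>>0. \<exists>xb. \<exists>tb\<ge>t0. min xb (\<Lambda> * xb) \<ge> x0 \<and>
           (\<forall>t\<ge>tb. (SUP x\<in>{xb..}. ereal \<bar>L t (\<Lambda> * x) / L t x - 1\<bar>) < ereal \<eta>)))}"

definition class_L_plus :: "real \<Rightarrow> (real \<Rightarrow> real \<Rightarrow> real) set" where
  "class_L_plus \<alpha> = {L \<in> class_L. \<exists>x1>0. \<forall>t\<ge>0. mono_on {x1..} (\<lambda>x. x powr \<alpha> * L t x)}"

definition locally_bounded_variation :: "(real \<Rightarrow> real) \<Rightarrow> bool" where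
  "locally_bounded_variation f \<longleftrightarrow>
     (\<forall>a b. bdd_above {(\<Sum>i<n. \<bar>f (p (Suc i)) - f (p i)\<bar>) | (n::nat) (p::nat \<Rightarrow> real).
                        mono_on {..n} p \<and> p ` {..n} \<subseteq> {a..b}})"

text \<open>
  The Lebesgue--Stieltjes measure of a non-decreasing function \<open>F\<close>, which need not be
  right-continuous. The constant \<^const>\<open>interval_measure\<close> is meaningful only for
  right-continuous functions, hence the passage to right limits: the measure of \<open>{a<..b}\<close> is
  \<open>F(b+) - F(a+)\<close>.
\<close>

definition stieltjes_measure :: "(real \<Rightarrow> real) \<Rightarrow> real measure" where
  "stieltjes_measure F = interval_measure (\<lambda>x. Lim (at_right x) F)"

text \<open>
  The integrand being positive, existence of the transform of a non-decreasing function is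
  integrability, which also agrees with convergence of the improper integral.
\<close>

definition laplace_stieltjes_exists :: "(real \<Rightarrow> real) \<Rightarrow> real \<Rightarrow> bool" where
  "laplace_stieltjes_exists F s \<longleftrightarrow> integrable (stieltjes_measure F) (\<lambda>x. exp (- s * x))"

definition laplace_stieltjes :: "(real \<Rightarrow> real) \<Rightarrow> real \<Rightarrow> real" where
  "laplace_stieltjes F s = (LINT x|stieltjes_measure F. exp (- s * x))"

end

theory Submission
  imports Defs "HOL-Probability.Giry_Monad" "HOL-Real_Asymp.Real_Asymp"
begin

text \<open>
  Karamata's method, made uniform by a filter. Weight the Stieltjes measure of \<open>G t\<close> by
  \<open>exp (- y / x) / (L t x * x powr \<alpha>)\<close> and push it forward under \<open>y \<mapsto> z = exp (- y / x)\<close>. The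
  moments of the image are values of the transform at \<open>k / x\<close>, so they converge, uniformly in
  \<open>x \<ge> 1 / s t\<close>, to the moments of the image of the measure \<open>d(y powr \<alpha>)\<close> on the half-line, which
  lives on the unit interval. Since the transform is bilateral, the images live on all of
  \<open>z > 0\<close>, where Weierstrass' theorem is not available; but the moments of the limit stay bounded,
  so a weight \<open>z ^ m\<close> of large degree controls the error of a polynomial approximation beyond
  the compact interval \<open>{0..2}\<close>. This gives convergence of the integrals of bounded continuous
  functions, and finally of the distribution functions at every \<open>b > 0\<close>, where the limit
  \<open>b powr \<alpha>\<close> is continuous. Evaluating at \<open>b = 1\<close> and at \<open>b\<close> slightly below \<open>1\<close> brackets
  \<open>G t x\<close>, which need not be right-continuous.
\<close>

section \<open>Convergence of moments\<close>

text \<open>Weierstrass approximation handles \<open>{0..2}\<close>. Beyond 2 both \<open>g\<close>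
  and the polynomial are at most a constant times \<open>z ^ n\<close>, and a further factor
  \<open>z ^ j\<close>, being at least \<open>2 ^ j\<close>, makes up for the constant and for the
  small \<epsilon>.\<close>

lemma polynomial_approx_weighted:
  fixes g :: "real \<Rightarrow> real"
  assumes cont: "continuous_on {0..} g" and bound: "\<And>z. z \<ge> 0 \<Longrightarrow> \<bar>g z\<bar> \<le> B" and eps: "\<epsilon> > 0"
  obtains a :: "nat \<Rightarrow> real" and n m :: nat
    where "\<And>z. z \<ge> 0 \<Longrightarrow> \<bar>g z - (\<Sum>i\<le>n. a i * z ^ i)\<bar> \<le> \<epsilon> * (1 + z ^ m)"
proof -
  have "continuous_on {0..2} g"
    using cont by (rule continuous_on_subset) auto
  then obtain p where p: "real_polynomial_function p" and near: "\<And>z. z \<in> {0..2} \<Longrightarrow> \<bar>g z - p z\<bar> < \<epsilon>"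
    using Stone_Weierstrass_real_polynomial_function[OF compact_Icc _ eps] by metis
  from p obtain a n where p_eq: "p = (\<lambda>z. \<Sum>i\<le>n. a i * z ^ i)"
    unfolding real_polynomial_function_iff_sum by blast
  \<comment> \<open>For \<open>z > 2\<close>, \<open>C * z ^ n\<close> dominates the sum of
    \<open>\<bar>g z\<bar>\<close> and the modulus of the polynomial.\<close>
  define C where "C = B + (\<Sum>i\<le>n. \<bar>a i\<bar>)"
  obtain j :: nat where "C / \<epsilon> < 2 ^ j"
    using real_arch_pow[of 2 "C / \<epsilon>"] by auto
  then have j: "C \<le> \<epsilon> * 2 ^ j"
    using eps by (simp add: divide_less_eq mult.commute)
  show thesis
  proof (rule that)
    fix z :: real assume z: "z \<ge> 0"
    show "\<bar>g z - (\<Sum>i\<le>n. a i * z ^ i)\<bar> \<le> \<epsilon> * (1 + z ^ (j + n))"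
    proof (cases "z \<le> 2")
      case True
      then have "\<bar>g z - p z\<bar> < \<epsilon>" using near z by auto
      moreover have "0 \<le> \<epsilon> * z ^ (j + n)" using eps z by simp
      ultimately show ?thesis by (simp add: p_eq algebra_simps)
    next
      case False
      have B: "0 \<le> B" using bound[OF z] by linarith
      have zn: "z ^ i \<le> z ^ n" if "i \<le> n" for i using that False by (intro power_increasing) auto
      have "\<bar>g z - (\<Sum>i\<le>n. a i * z ^ i)\<bar> \<le> \<bar>g z\<bar> + \<bar>\<Sum>i\<le>n. a i * z ^ i\<bar>" by linarith
      also have "\<dots> \<le> B * z ^ n + (\<Sum>i\<le>n. \<bar>a i\<bar> * z ^ n)"
      proof (rule add_mono)
        have "\<bar>g z\<bar> \<le> B * 1" using bound[OF z] by simp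
        also have "\<dots> \<le> B * z ^ n" using B False zn[of 0] by (intro mult_left_mono) auto
        finally show "\<bar>g z\<bar> \<le> B * z ^ n" .
        have "\<bar>\<Sum>i\<le>n. a i * z ^ i\<bar> \<le> (\<Sum>i\<le>n. \<bar>a i * z ^ i\<bar>)" by (rule sum_abs)
        also have "\<dots> \<le> (\<Sum>i\<le>n. \<bar>a i\<bar> * z ^ n)"
          using zn z by (intro sum_mono) (auto simp: abs_mult intro!: mult_left_mono)
        finally show "\<bar>\<Sum>i\<le>n. a i * z ^ i\<bar> \<le> (\<Sum>i\<le>n. \<bar>a i\<bar> * z ^ n)" .
      qed
      also have "\<dots> = C * z ^ n" by (simp add: C_def sum_distrib_right distrib_right)
      also have "\<dots> \<le> (\<epsilon> * 2 ^ j) * z ^ n" using j z by (intro mult_right_mono) auto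
      also have "\<dots> \<le> (\<epsilon> * z ^ j) * z ^ n"
        using False z eps by (intro mult_right_mono mult_left_mono power_mono) auto
      also have "\<dots> \<le> \<epsilon> * (1 + z ^ (j + n))"
        using eps by (simp add: power_add algebra_simps)
      finally show ?thesis .
    qed
  qed
qed

text \<open>What matters is the order of choices: \<epsilon> is fixed from the total mass
  \<open>K\<close> of \<open>N\<close>, before the degree \<open>m\<close> is known. This is
  legitimate because \<open>N\<close> lives on the unit interval, so that each of its moments is at
  most \<open>K\<close>; by convergence the \<open>m\<close>-th moment of \<open>M i\<close> is
  eventually not much larger, whatever mass \<open>M i\<close> has beyond 1.\<close>

lemma moment_convergence:
  fixes M :: "'i \<Rightarrow> real measure" and N :: "real measure"
  assumes sets_M: "\<And>i. sets (M i) = sets borel" and sets_N: "sets N = sets borel"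
    and M_nonneg: "\<And>i. AE z in M i. 0 \<le> z" and N_unit: "AE z in N. 0 \<le> z \<and> z \<le> 1"
    and N_finite: "finite_measure N"
    and M_int: "\<And>k. \<forall>\<^sub>F i in F. integrable (M i) (\<lambda>z. z ^ k)"
    and moments: "\<And>k. ((\<lambda>i. LINT z|M i. z ^ k) \<longlongrightarrow> (LINT z|N. z ^ k)) F"
    and g_meas: "(g :: real \<Rightarrow> real) \<in> borel_measurable borel"
    and g_cont: "continuous_on {0..} g" and g_bound: "\<And>z. z \<ge> 0 \<Longrightarrow> \<bar>g z\<bar> \<le> B"
  shows "((\<lambda>i. LINT z|M i. g z) \<longlongrightarrow> (LINT z|N. g z)) F"
proof (rule tendstoI)
  fix e :: real assume e: "e > 0"
  note [measurable_cong] = sets_M sets_N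
  note [measurable] = g_meas
  interpret N: finite_measure N by (rule N_finite)
  define K where "K = measure N (space N)"
  \<comment> \<open>The errors below add up to at most \<open>\<epsilon> * (4 * K + 2)\<close>:
    \<open>2 * K + 1\<close> from \<open>M i\<close>, \<open>1\<close> from the convergence of the
    polynomial integrals and \<open>2 * K\<close> from \<open>N\<close>.\<close>
  define \<epsilon> where "\<epsilon> = e / (4 * K + 3)"
  have K: "K \<ge> 0" by (simp add: K_def)
  then have eps: "\<epsilon> > 0" using e by (simp add: \<epsilon>_def)
  obtain a n m where approx: "\<And>z. z \<ge> 0 \<Longrightarrow> \<bar>g z - (\<Sum>i\<le>n. a i * z ^ i)\<bar> \<le> \<epsilon> * (1 + z ^ m)"
    using polynomial_approx_weighted[OF g_cont g_bound eps] by blast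
  define p where "p z = (\<Sum>i\<le>n. a i * z ^ i)" for z :: real
  have [measurable]: "p \<in> borel_measurable borel" unfolding p_def by measurable
  \<comment> \<open>Stated for a general \<open>Q\<close>, as it serves both for \<open>N\<close>
    and for each \<open>M i\<close>: the cost of replacing \<open>g\<close> by the polynomial is
    controlled by just two moments.\<close>
  have key: "\<bar>(LINT z|Q. g z) - (LINT z|Q. p z)\<bar> \<le> \<epsilon> * ((LINT z|Q. z ^ 0) + (LINT z|Q. z ^ m))"
    if Q: "sets Q = sets borel" "AE z in Q. 0 \<le> z" and int: "\<forall>k\<in>{..max n m}. integrable Q (\<lambda>z. z ^ k)"
    for Q :: "real measure"
  proof -
    note [measurable_cong] = Q(1)
    have int_p: "integrable Q p" unfolding p_def using int by (intro Bochner_Integration.integrable_sum Bochner_Integration.integrable_mult_right) auto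
    have int_0: "integrable Q (\<lambda>z. 1 :: real)" using int[rule_format, of 0] by simp
    have int_m: "integrable Q (\<lambda>z. z ^ m)" using int by auto
    have int_g: "integrable Q g"
      by (rule Bochner_Integration.integrable_bound[OF integrable_mult_right[OF int_0, of B]])
        (use Q(2) g_bound in \<open>measurable, fastforce elim!: eventually_mono\<close>)
    have "\<bar>(LINT z|Q. g z) - (LINT z|Q. p z)\<bar> = \<bar>LINT z|Q. g z - p z\<bar>"
      using int_g int_p by simp
    also have "\<dots> \<le> (LINT z|Q. \<bar>g z - p z\<bar>)" by (rule integral_abs_bound)
    also have "\<dots> \<le> (LINT z|Q. \<epsilon> * (1 + z ^ m))"
    proof (rule integral_mono_AE)
      show "integrable Q (\<lambda>z. \<bar>g z - p z\<bar>)" "integrable Q (\<lambda>z. \<epsilon> * (1 + z ^ m))"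
        using int_g int_p int_0 int_m by simp_all
      show "AE z in Q. \<bar>g z - p z\<bar> \<le> \<epsilon> * (1 + z ^ m)"
        using Q(2) by eventually_elim (simp add: p_def approx)
    qed
    also have "\<dots> = \<epsilon> * ((LINT z|Q. z ^ 0) + (LINT z|Q. z ^ m))"
      using int_0 int_m by simp
    finally show ?thesis .
  qed
  have N_power: "AE z in N. \<bar>z ^ k\<bar> \<le> 1" for k
    using N_unit by eventually_elim (simp add: power_le_one)
  have N_int: "integrable N (\<lambda>z. z ^ k)" for k
    by (rule N.integrable_const_bound[where B = 1]) (use N_power[of k] in auto)
  have N_moment: "(LINT z|N. z ^ k) \<le> K" for k
  proof -
    have "(LINT z|N. z ^ k) \<le> (LINT z|N. 1)"
      using N_int N_power[of k] by (intro integral_mono_AE) (auto elim!: eventually_mono)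
    then show ?thesis by (simp add: K_def)
  qed
  have "\<bar>(LINT z|N. g z) - (LINT z|N. p z)\<bar> \<le> \<epsilon> * ((LINT z|N. z ^ 0) + (LINT z|N. z ^ m))"
    using N_unit N_int by (intro key sets_N) (auto elim!: eventually_mono)
  also have "\<dots> \<le> \<epsilon> * (K + K)"
    using eps by (intro mult_left_mono add_mono N_moment) auto
  finally have N_close: "\<bar>(LINT z|N. g z) - (LINT z|N. p z)\<bar> \<le> \<epsilon> * (2 * K)" by simp
  \<comment> \<open>How far along \<open>F\<close> integrability starts may depend on
    \<open>k\<close>, but only the finitely many powers up to \<open>max n m\<close> occur.\<close>
  have M_int': "\<forall>\<^sub>F i in F. \<forall>k\<in>{..max n m}. integrable (M i) (\<lambda>z. z ^ k)"
    using M_int by (simp add: eventually_ball_finite)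
  have int_p_eq: "(LINT z|Q. p z) = (\<Sum>k\<le>n. a k * (LINT z|Q. z ^ k))"
    if "\<forall>k\<in>{..max n m}. integrable Q (\<lambda>z. z ^ k)" for Q :: "real measure"
    unfolding p_def using that by (subst Bochner_Integration.integral_sum) auto
  have "((\<lambda>i. \<Sum>k\<le>n. a k * (LINT z|M i. z ^ k)) \<longlongrightarrow> (LINT z|N. p z)) F"
    using N_int by (subst int_p_eq) (auto intro!: tendsto_intros moments)
  then have "\<forall>\<^sub>F i in F. dist (\<Sum>k\<le>n. a k * (LINT z|M i. z ^ k)) (LINT z|N. p z) < \<epsilon>"
    using eps by (rule tendstoD)
  moreover have "\<forall>\<^sub>F i in F. (LINT z|M i. z ^ 0) + (LINT z|M i. z ^ m) < 2 * K + 1"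
    using N_moment[of 0] N_moment[of m]
    by (intro order_tendstoD(2)[OF tendsto_add[OF moments moments]]) linarith
  ultimately show "\<forall>\<^sub>F i in F. dist (LINT z|M i. g z) (LINT z|N. g z) < e"
    using M_int'
  proof eventually_elim
    case (elim i)
    have "\<bar>(LINT z|M i. g z) - (LINT z|M i. p z)\<bar> \<le> \<epsilon> * ((LINT z|M i. z ^ 0) + (LINT z|M i. z ^ m))"
      using M_nonneg elim(3) by (intro key sets_M) auto
    also have "\<dots> \<le> \<epsilon> * (2 * K + 1)"
      using elim(2) eps by (intro mult_left_mono) auto
    finally have "\<bar>(LINT z|M i. g z) - (LINT z|M i. p z)\<bar> \<le> \<epsilon> * (2 * K + 1)" .
    moreover have "\<bar>(LINT z|M i. p z) - (LINT z|N. p z)\<bar> < \<epsilon>"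
      using elim(1) by (simp add: int_p_eq[OF elim(3)] dist_real_def)
    ultimately have "\<bar>(LINT z|M i. g z) - (LINT z|N. g z)\<bar> < \<epsilon> * (2 * K + 1) + \<epsilon> + \<epsilon> * (2 * K)"
      using N_close by linarith
    also have "\<dots> = \<epsilon> * (4 * K + 2)" by (simp add: algebra_simps)
    also have "\<dots> \<le> \<epsilon> * (4 * K + 3)" using eps by simp
    also have "\<dots> = e" using K by (simp add: \<epsilon>_def)
    finally show ?case by (simp add: dist_real_def)
  qed
qed

text \<open>This is the measure \<open>d(y powr \<alpha>)\<close> on the half-line. For
  \<open>\<alpha> = 0\<close> the density \<open>\<alpha> * y powr (\<alpha> - 1)\<close> would
  vanish, and the measure is the unit mass at 0 instead; its jump is the reason for asking about
  \<open>{..b}\<close> only for \<open>b > 0\<close>.\<close>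

lemma ex_power_measure:
  assumes "\<alpha> \<ge> 0"
  shows "\<exists>\<mu> :: real measure. sets \<mu> = sets borel \<and> (AE y in \<mu>. 0 \<le> y) \<and>
    (\<forall>b>0. measure \<mu> {..b} = b powr \<alpha>) \<and>
    (\<forall>u>0. has_bochner_integral \<mu> (\<lambda>y. exp (- (u * y))) (Gamma (\<alpha> + 1) * u powr (- \<alpha>)))"
proof (cases "\<alpha> = 0")
  case True
  have "has_bochner_integral (return borel 0) (\<lambda>y. exp (- (u * y))) 1" for u :: real
    by (rule has_bochner_integral_nn_integral) (auto simp: nn_integral_return)
  then show ?thesis
    using True by (intro exI[of _ "return borel 0"])
      (auto simp: AE_return measure_return indicator_def)
next
  case False
  with assms have \<alpha>: "\<alpha> > 0" by simp
  define f where "f y = indicator {0..} y * (\<alpha> * y powr (\<alpha> - 1))" for y :: real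
  have [measurable]: "f \<in> borel_measurable borel" unfolding f_def by measurable
  have f_nonneg: "f y \<ge> 0" for y using \<alpha> by (simp add: f_def)
  define \<mu> where "\<mu> = density lborel f"
  have sets: "sets \<mu> = sets borel" by (simp add: \<mu>_def)
  have "AE y in \<mu>. 0 \<le> y"
    unfolding \<mu>_def by (subst AE_density) (auto simp: f_def indicator_def split: if_splits)
  moreover have "measure \<mu> {..b} = b powr \<alpha>" if b: "b > 0" for b
  proof -
    have "((\<lambda>y. \<alpha> * y powr (\<alpha> - 1)) has_integral \<alpha> * (b powr (\<alpha> - 1 + 1) / (\<alpha> - 1 + 1))) {0..b}"
      using \<alpha> b by (intro has_integral_mult_right has_integral_powr_from_0) auto
    then have I: "((\<lambda>y. \<alpha> * y powr (\<alpha> - 1)) has_integral b powr \<alpha>) {0..b}" using \<alpha> by simp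
    have "emeasure \<mu> {..b} = (\<integral>\<^sup>+y. ennreal (f y) * indicator {..b} y \<partial>lborel)"
      unfolding \<mu>_def by (subst emeasure_density) auto
    also have "\<dots> = (\<integral>\<^sup>+y. ennreal (indicator {0..b} y * (\<alpha> * y powr (\<alpha> - 1))) \<partial>lborel)"
      by (intro nn_integral_cong) (auto simp: f_def indicator_def)
    also have "\<dots> = ennreal (b powr \<alpha>)"
      using \<alpha> by (intro nn_integral_has_integral_lebesgue[OF _ I]) auto
    finally show ?thesis by (simp add: measure_def)
  qed
  moreover have "has_bochner_integral \<mu> (\<lambda>y. exp (- (u * y))) (Gamma (\<alpha> + 1) * u powr (- \<alpha>))"
    if u: "u > 0" for u
  proof (rule has_bochner_integral_nn_integral)
    show "(\<lambda>y. exp (- (u * y))) \<in> borel_measurable \<mu>"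
      using sets by measurable
    show "0 \<le> Gamma (\<alpha> + 1) * u powr - \<alpha>" using \<alpha> by (simp add: Gamma_real_pos less_imp_le)
    have "(\<integral>\<^sup>+y. ennreal (exp (- (u * y))) \<partial>\<mu>) = (\<integral>\<^sup>+y. ennreal (f y * exp (- (u * y))) \<partial>lborel)"
      unfolding \<mu>_def using f_nonneg
      by (subst nn_integral_density) (auto simp: ennreal_mult)
    \<comment> \<open>The substitution \<open>y = t / u\<close> pulls out
      \<open>u powr - \<alpha>\<close> and leaves Euler's integral for
      \<open>Gamma \<alpha>\<close>; the factor \<alpha> then turns it into
      \<open>Gamma (\<alpha> + 1)\<close>.\<close>
    also have "\<dots> = (\<integral>\<^sup>+t. ennreal (\<bar>1 / u\<bar>) * ennreal (f (0 + 1 / u * t) * exp (- (u * (0 + 1 / u * t)))) \<partial>lborel)"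
      using u by (subst nn_integral_real_affine[where c = "1 / u" and t = 0])
        (auto simp: nn_integral_cmult)
    also have "\<dots> = (\<integral>\<^sup>+t. ennreal (\<alpha> * u powr - \<alpha>) *
        ennreal (indicator {0..} t * t powr (\<alpha> - 1) / exp t) \<partial>lborel)"
    proof (intro nn_integral_cong)
      fix t :: real
      have "\<bar>1 / u\<bar> * (f (0 + 1 / u * t) * exp (- (u * (0 + 1 / u * t)))) =
          \<alpha> * u powr - \<alpha> * (indicator {0..} t * t powr (\<alpha> - 1) / exp t)"
        using u by (auto simp: f_def indicator_def powr_divide powr_minus powr_diff exp_minus
            field_simps zero_le_divide_iff)
      then show "ennreal (\<bar>1 / u\<bar>) * ennreal (f (0 + 1 / u * t) * exp (- (u * (0 + 1 / u * t)))) =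
          ennreal (\<alpha> * u powr - \<alpha>) * ennreal (indicator {0..} t * t powr (\<alpha> - 1) / exp t)"
        using \<alpha> f_nonneg by (subst (1 2) ennreal_mult[symmetric]) auto
    qed
    also have "\<dots> = ennreal (\<alpha> * u powr - \<alpha>) * ennreal (Gamma \<alpha>)"
      using \<alpha> by (subst nn_integral_cmult) (auto simp: Gamma_conv_nn_integral_real)
    also have "\<dots> = ennreal (Gamma (\<alpha> + 1) * u powr - \<alpha>)"
      using \<alpha> Gamma_real_pos[of \<alpha>] Gamma_plus1[of \<alpha>]
      by (subst ennreal_mult[symmetric]) (auto simp: mult_ac nonpos_Ints_def)
    finally show "(\<integral>\<^sup>+y. ennreal (exp (- (u * y))) \<partial>\<mu>) = ennreal (Gamma (\<alpha> + 1) * u powr - \<alpha>)" .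
  qed auto
  ultimately show ?thesis using sets by blast
qed

section \<open>The Tauberian theorem for filtered families of measures\<close>

text \<open>The exponential weight makes the image finite as soon as the transform of
  \<open>M\<close> exists at \<open>u\<close>, even if \<open>M\<close> has infinite mass. It also
  shifts the moments by one: the moment of order \<open>k\<close> is the transform at
  \<open>(k + 1) * u\<close>, divided by \<open>c\<close>.\<close>

definition laplace_image :: "real measure \<Rightarrow> real \<Rightarrow> real \<Rightarrow> real measure" where
  "laplace_image M u c =
     distr (density M (\<lambda>y. ennreal (exp (- (u * y)) / c))) borel (\<lambda>y. exp (- (u * y)))"

lemma sets_laplace_image [simp]: "sets (laplace_image M u c) = sets borel"
  by (simp add: laplace_image_def)

lemma
  fixes f :: "real \<Rightarrow> real"
  assumes M: "sets M = sets borel" and c: "c > 0" and f: "f \<in> borel_measurable borel"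
  shows integral_laplace_image:
      "(LINT z|laplace_image M u c. f z) = (LINT y|M. exp (- (u * y)) * f (exp (- (u * y)))) / c"
    and integrable_laplace_image:
      "integrable (laplace_image M u c) f \<longleftrightarrow> integrable M (\<lambda>y. exp (- (u * y)) * f (exp (- (u * y))))"
proof -
  note [measurable_cong] = M and [measurable] = f
  have "(LINT z|laplace_image M u c. f z) = (LINT y|M. (exp (- (u * y)) / c) *\<^sub>R f (exp (- (u * y))))"
    unfolding laplace_image_def
    by (subst integral_distr, simp, simp) (use c in \<open>subst integral_density; auto\<close>)
  also have "\<dots> = (LINT y|M. (exp (- (u * y)) * f (exp (- (u * y)))) / c)"
    by (simp add: field_simps)
  also have "\<dots> = (LINT y|M. exp (- (u * y)) * f (exp (- (u * y)))) / c"
    by (rule integral_divide_zero)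
  finally show "(LINT z|laplace_image M u c. f z) = (LINT y|M. exp (- (u * y)) * f (exp (- (u * y)))) / c" .
  have "integrable (laplace_image M u c) f \<longleftrightarrow>
      integrable M (\<lambda>y. (exp (- (u * y)) / c) *\<^sub>R f (exp (- (u * y))))"
    unfolding laplace_image_def
    by (subst integrable_distr_eq, simp, simp) (use c in \<open>subst integrable_density; auto\<close>)
  also have "\<dots> \<longleftrightarrow> integrable M (\<lambda>y. (exp (- (u * y)) * f (exp (- (u * y)))) / c)"
    by (simp add: field_simps)
  also have "\<dots> \<longleftrightarrow> integrable M (\<lambda>y. exp (- (u * y)) * f (exp (- (u * y))))"
    using c by (simp only: divide_inverse integrable_mult_left_iff) simp
  finally show "integrable (laplace_image M u c) f \<longleftrightarrow>
      integrable M (\<lambda>y. exp (- (u * y)) * f (exp (- (u * y))))" .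
qed

lemma AE_laplace_image_pos:
  assumes "sets M = sets borel"
  shows "AE z in laplace_image M u c. 0 < z"
proof -
  note [measurable_cong] = assms
  show ?thesis unfolding laplace_image_def by (subst AE_distr_iff) auto
qed

lemma
  assumes M: "sets M = sets borel" and c: "c > 0"
  shows moment_laplace_image: "(LINT z|laplace_image M u c. z ^ k) =
      (LINT y|M. exp (- (real (Suc k) * u * y))) / c"
    and integrable_moment_laplace_image: "integrable (laplace_image M u c) (\<lambda>z. z ^ k) \<longleftrightarrow>
      integrable M (\<lambda>y. exp (- (real (Suc k) * u * y)))"
proof -
  have "exp (- (u * y)) * exp (- (u * y)) ^ k = exp (- (real (Suc k) * u * y))" for y
    by (simp flip: exp_of_nat_mult exp_add) (simp add: algebra_simps)
  then show "(LINT z|laplace_image M u c. z ^ k) = (LINT y|M. exp (- (real (Suc k) * u * y))) / c"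
    and "integrable (laplace_image M u c) (\<lambda>z. z ^ k) \<longleftrightarrow>
      integrable M (\<lambda>y. exp (- (real (Suc k) * u * y)))"
    using M c by (simp_all add: integral_laplace_image integrable_laplace_image)
qed

text \<open>
  With \<open>z = exp (- y)\<close>, a continuous substitute for the indicator of \<open>y \<le> b\<close>, divided by \<open>z\<close>
  to undo the weight in \<^const>\<open>laplace_image\<close>.
\<close>

definition cutoff :: "real \<Rightarrow> real \<Rightarrow> real \<Rightarrow> real" where
  "cutoff b b' z =
     max 0 (min 1 ((z - exp (- b')) / (exp (- b) - exp (- b')))) / max z (exp (- b'))"

lemma continuous_on_cutoff: "b < b' \<Longrightarrow> continuous_on A (cutoff b b')"
  unfolding cutoff_def
  by (intro continuous_intros) (auto simp: max_def not_less intro: less_le_trans[OF exp_gt_zero])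

text \<open>The maximum in the denominator of \<open>cutoff\<close> keeps the function continuous
  and bounded down to \<open>z = 0\<close>. It changes no value at a positive \<open>z\<close>:
  where it differs from \<open>z\<close>, the numerator is 0. Hence multiplication by
  \<open>z = exp (- y)\<close> leaves just the numerator, which is 1 for \<open>y \<le> b\<close>
  and 0 for \<open>y \<ge> b'\<close>.\<close>

lemma cutoff_bounds:
  assumes "b < b'"
  shows "\<bar>cutoff b b' z\<bar> \<le> exp b'"
    and "indicator {..b} y \<le> exp (- y) * cutoff b b' (exp (- y))"
    and "exp (- y) * cutoff b b' (exp (- y)) \<le> indicator {..b'} y"
proof -
  let ?n = "\<lambda>z. max 0 (min 1 ((z - exp (- b')) / (exp (- b) - exp (- b'))))"
  have d: "0 < exp (- b) - exp (- b')" using assms by simp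
  have n: "0 \<le> ?n z" "?n z \<le> 1" for z by auto
  have m: "exp (- b') \<le> max z (exp (- b'))" for z by simp
  have "\<bar>cutoff b b' z\<bar> = ?n z / max z (exp (- b'))"
    unfolding cutoff_def using n(1)[of z] less_le_trans[OF exp_gt_zero m]
    by (intro abs_of_nonneg divide_nonneg_nonneg) (auto simp: less_imp_le)
  also have "\<dots> \<le> 1 / exp (- b')"
    using n m by (intro frac_le) auto
  finally show "\<bar>cutoff b b' z\<bar> \<le> exp b'" by (simp add: exp_minus inverse_eq_divide)
  show "indicator {..b} y \<le> exp (- y) * cutoff b b' (exp (- y))"
  proof (cases "y \<le> b")
    case True
    then have "?n (exp (- y)) = 1" using d by (simp add: le_divide_eq)
    moreover have "max (exp (- y)) (exp (- b')) = exp (- y)" using True assms by simp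
    ultimately show ?thesis by (simp add: cutoff_def)
  next
    case False
    then show ?thesis using n(1)[of "exp (- y)"] m[of "exp (- y)"]
      unfolding cutoff_def
      by (auto simp: indicator_def intro!: mult_nonneg_nonneg divide_nonneg_nonneg
          simp: le_max_iff_disj)
  qed
  show "exp (- y) * cutoff b b' (exp (- y)) \<le> indicator {..b'} y"
  proof (cases "y \<le> b'")
    case True
    then have "max (exp (- y)) (exp (- b')) = exp (- y)" by simp
    then show ?thesis using True n(2)[of "exp (- y)"] by (simp add: cutoff_def)
  next
    case False
    then have "(exp (- y) - exp (- b')) / (exp (- b) - exp (- b')) \<le> 0"
      using d by (intro divide_nonpos_pos) auto
    then have "cutoff b b' (exp (- y)) = 0" unfolding cutoff_def by simp
    then show ?thesis by simp
  qed
qed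

text \<open>The weight \<open>exp (- (u * y))\<close> of the image cancels the division by
  \<open>z\<close> in \<open>cutoff\<close>, so that the integral lies between normalised
  distribution functions of \<open>M\<close> itself.\<close>

lemma integral_cutoff_bounds:
  assumes M: "sets M = sets borel" and c: "c > 0" and u: "u > 0" and b: "b < b'"
    and int: "integrable M (\<lambda>y. exp (- (u * y)))"
  shows "measure M {..b / u} / c \<le> (LINT z|laplace_image M u c. cutoff b b' z)"
    and "(LINT z|laplace_image M u c. cutoff b b' z) \<le> measure M {..b' / u} / c"
proof -
  note [measurable_cong] = M
  have meas [measurable]: "cutoff b b' \<in> borel_measurable borel"
    using continuous_on_cutoff[OF b] by (rule borel_measurable_continuous_onI)
  \<comment> \<open>A Chernoff bound: \<open>exp (a - u * y)\<close> is at least 1 on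
    \<open>{..a / u}\<close>. Half-lines thus have finite measure although \<open>M\<close> need not
    be finite.\<close>
  have int_ind: "integrable M (indicator {..a / u} :: real \<Rightarrow> real)" for a
  proof (rule Bochner_Integration.integrable_bound)
    show "integrable M (\<lambda>y. exp a * exp (- (u * y)))" using int by simp
    show "AE y in M. norm (indicator {..a / u} y :: real) \<le> norm (exp a * exp (- (u * y)))"
      using u by (auto simp: indicator_def field_simps simp flip: exp_add)
  qed measurable
  have ind: "indicator {..a} (u * y) = (indicator {..a / u} y :: real)" for a y
    using u by (auto simp: indicator_def field_simps)
  note bounds = cutoff_bounds(2,3)[OF b, of "u * y" for y, unfolded ind]
  have int_cut: "integrable M (\<lambda>y. exp (- (u * y)) * cutoff b b' (exp (- (u * y))))"
  proof (rule Bochner_Integration.integrable_bound[OF int_ind[of b']])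
    have "0 \<le> exp (- (u * y)) * cutoff b b' (exp (- (u * y)))" for y
      by (rule order_trans[OF _ bounds(1)]) simp
    then show "AE y in M. norm (exp (- (u * y)) * cutoff b b' (exp (- (u * y))))
        \<le> norm (indicator {..b' / u} y :: real)"
      using bounds(2) by simp
  qed measurable
  have measure_eq: "measure M {..a / u} = (LINT y|M. indicator {..a / u} y)" for a
    using M sets_eq_imp_space_eq[OF M] by simp
  show "measure M {..b / u} / c \<le> (LINT z|laplace_image M u c. cutoff b b' z)"
    unfolding integral_laplace_image[OF M c meas] measure_eq
    using c bounds int_ind int_cut by (intro divide_right_mono integral_mono) auto
  show "(LINT z|laplace_image M u c. cutoff b b' z) \<le> measure M {..b' / u} / c"
    unfolding integral_laplace_image[OF M c meas] measure_eq
    using c bounds int_ind int_cut by (intro divide_right_mono integral_mono) auto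
qed

text \<open>All hypotheses are limits or eventual statements along an arbitrary filter, so
  uniformity is obtained by the choice of \<open>F\<close>. The intended index is a pair
  \<open>(t, x)\<close>, with scale \<open>u = 1 / x\<close> and normalisation
  \<open>c = L t x * x powr \<alpha>\<close>.\<close>

theorem karamata_tauberian_filter:
  fixes M :: "'i \<Rightarrow> real measure" and u c :: "'i \<Rightarrow> real"
  assumes alpha: "\<alpha> \<ge> 0"
    and sets_M: "\<And>i. sets (M i) = sets borel"
    and pos: "\<forall>\<^sub>F i in F. 0 < u i" "\<forall>\<^sub>F i in F. 0 < c i"
    and int: "\<And>k. \<forall>\<^sub>F i in F. integrable (M i) (\<lambda>y. exp (- (real (Suc k) * u i * y)))"
    and lim: "\<And>k. ((\<lambda>i. (LINT y|M i. exp (- (real (Suc k) * u i * y))) / c i)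
      \<longlongrightarrow> Gamma (\<alpha> + 1) * real (Suc k) powr - \<alpha>) F"
    and b: "b > 0"
  shows "((\<lambda>i. measure (M i) {..b / u i} / c i) \<longlongrightarrow> b powr \<alpha>) F"
proof -
  obtain \<mu> :: "real measure" where sets_mu: "sets \<mu> = sets borel"
    and mu_nonneg: "AE y in \<mu>. 0 \<le> y"
    and mu_cdf: "\<And>b. b > 0 \<Longrightarrow> measure \<mu> {..b} = b powr \<alpha>"
    and mu_laplace: "\<And>v. v > 0 \<Longrightarrow>
      has_bochner_integral \<mu> (\<lambda>y. exp (- (v * y))) (Gamma (\<alpha> + 1) * v powr (- \<alpha>))"
    using ex_power_measure[OF alpha] by blast
  note [measurable_cong] = sets_mu
  define N where "N = laplace_image \<mu> 1 1"
  define M' where "M' i = laplace_image (M i) (u i) (c i)" for i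
  have mu_int: "integrable \<mu> (\<lambda>y. exp (- (real (Suc k) * 1 * y)))" for k
    using mu_laplace[of "real (Suc k)"] by (simp add: has_bochner_integral_iff)
  have N_moment: "(LINT z|N. z ^ k) = Gamma (\<alpha> + 1) * real (Suc k) powr - \<alpha>" for k
    using mu_laplace[of "real (Suc k)"] moment_laplace_image[OF sets_mu, of 1 1 k]
    by (simp add: N_def has_bochner_integral_iff)
  have N_finite: "finite_measure N"
  proof -
    have "integrable N (\<lambda>z. z ^ 0)"
      unfolding N_def using mu_int[of 0] sets_mu by (subst integrable_moment_laplace_image) auto
    then show ?thesis by (simp add: integrable_iff_bounded finite_measureI)
  qed
  have conv: "((\<lambda>i. LINT z|M' i. cutoff d d' z) \<longlongrightarrow> (LINT z|N. cutoff d d' z)) F" if d: "d < d'" for d d'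
  proof (rule moment_convergence[where B = "exp d'"])
    show "AE z in M' i. 0 \<le> z" for i
      unfolding M'_def by (rule eventually_mono[OF AE_laplace_image_pos[OF sets_M]]) simp
    \<comment> \<open>Here the limit measure being carried by \<open>y \<ge> 0\<close> enters. The
      measures \<open>M i\<close> may charge negative \<open>y\<close>, that is
      \<open>z > 1\<close>.\<close>
    show "AE z in N. 0 \<le> z \<and> z \<le> 1"
      unfolding N_def laplace_image_def using mu_nonneg
      by (subst AE_distr_iff) (auto simp: AE_density elim!: eventually_mono)
    show "\<forall>\<^sub>F i in F. integrable (M' i) (\<lambda>z. z ^ k)" for k
      using int[of k] pos(2)
      by eventually_elim (simp add: M'_def integrable_moment_laplace_image sets_M)
    show "((\<lambda>i. LINT z|M' i. z ^ k) \<longlongrightarrow> (LINT z|N. z ^ k)) F" for k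
    proof (rule Lim_transform_eventually)
      show "((\<lambda>i. (LINT y|M i. exp (- (real (Suc k) * u i * y))) / c i) \<longlongrightarrow> (LINT z|N. z ^ k)) F"
        using lim[of k] by (simp only: N_moment)
      show "\<forall>\<^sub>F i in F. (LINT y|M i. exp (- (real (Suc k) * u i * y))) / c i = (LINT z|M' i. z ^ k)"
        using pos(2) by eventually_elim (simp only: M'_def moment_laplace_image sets_M)
    qed
    show "cutoff d d' \<in> borel_measurable borel"
      using continuous_on_cutoff[OF d] by (rule borel_measurable_continuous_onI)
  qed (use N_finite d in \<open>auto simp: M'_def N_def continuous_on_cutoff cutoff_bounds\<close>)
  have powr_cont: "((\<lambda>b. b powr \<alpha>) \<longlongrightarrow> b powr \<alpha>) (at b within A)" for A
    using b by (intro tendsto_intros) auto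
  note mu_int_1 = mu_int[of 0, simplified]
  note int_1 = int[of 0, simplified]
  show ?thesis
  proof (rule order_tendstoI)
    fix a assume a: "a < b powr \<alpha>"
    have "\<forall>\<^sub>F d in at_left b. a < d powr \<alpha> \<and> d \<in> {0<..<b}"
      using order_tendstoD(1)[OF powr_cont a] eventually_at_left_real[OF b]
      by (rule eventually_conj)
    then obtain d where d: "a < d powr \<alpha>" "0 < d" "d < b"
      using eventually_happens'[OF trivial_limit_at_left_real] by auto
    \<comment> \<open>The cutoff descends from \<open>d\<close> to \<open>b\<close>: against the
      limit it is at least \<open>d powr \<alpha>\<close>, hence above \<open>a\<close>, while
      against \<open>M i\<close> it stays below the distribution function at \<open>b / u i\<close>.
      The upper bound below uses a cutoff descending from \<open>b\<close> to some
      \<open>d > b\<close> in the same way.\<close>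
    have "a < (LINT z|N. cutoff d b z)"
      using integral_cutoff_bounds(1)[OF sets_mu, of 1 1 d b] mu_int_1 mu_cdf[of d] d
      by (simp add: N_def)
    from order_tendstoD(1)[OF conv[OF d(3)] this] pos int_1
    show "\<forall>\<^sub>F i in F. a < measure (M i) {..b / u i} / c i"
    proof eventually_elim
      case (elim i)
      with integral_cutoff_bounds(2)[OF sets_M elim(3,2) d(3) elim(4)] show ?case
        by (simp add: M'_def)
    qed
  next
    fix a assume a: "b powr \<alpha> < a"
    have "\<forall>\<^sub>F d in at_right b. d powr \<alpha> < a \<and> d \<in> {b<..<b + 1}"
      using order_tendstoD(2)[OF powr_cont a] eventually_at_right_real[of b "b + 1"]
      by (intro eventually_conj) auto
    then obtain d where d: "d powr \<alpha> < a" "b < d"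
      using eventually_happens'[OF trivial_limit_at_right_real] by auto
    have "(LINT z|N. cutoff b d z) < a"
      using integral_cutoff_bounds(2)[OF sets_mu, of 1 1 b d] mu_int_1 mu_cdf[of d] d b
      by (simp add: N_def)
    from order_tendstoD(2)[OF conv[OF d(2)] this] pos int_1
    show "\<forall>\<^sub>F i in F. measure (M i) {..b / u i} / c i < a"
    proof eventually_elim
      case (elim i)
      with integral_cutoff_bounds(1)[OF sets_M elim(3,2) d(2) elim(4)] show ?case
        by (simp add: M'_def)
    qed
  qed
qed

section \<open>Stieltjes measures of monotone functions\<close>

text \<open>The measure of \<open>{..x}\<close> is the right limit \<open>F(x+)\<close>, which lies
  between \<open>F x\<close> and every later value of \<open>F\<close>. The limit 0 at minus
  infinity fixes the additive constant.\<close>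

lemma stieltjes_measure_bounds:
  assumes F: "mono F" and F0: "(F \<longlongrightarrow> 0) at_bot"
  shows "F x \<le> measure (stieltjes_measure F) {..x}"
    and "x < y \<Longrightarrow> measure (stieltjes_measure F) {..x} \<le> F y"
proof -
  have F_mono: "F x \<le> F y" if "x \<le> y" for x y using F that by (rule monoD)
  \<comment> \<open>For monotone \<open>F\<close> this infimum is the right limit. It is monotone
    and right-continuous, as \<open>interval_measure\<close> requires, even where \<open>F\<close>
    jumps.\<close>
  define R where "R x = Inf (F ` {x<..})" for x
  have bdd: "bdd_below (F ` {x<..})" for x
    by (intro bdd_belowI[of _ "F x"]) (auto intro: F_mono)
  have F_le: "F x \<le> R x" for x
    unfolding R_def by (intro cInf_greatest) (auto intro: F_mono)
  have le_F: "R x \<le> F y" if "x < y" for x y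
    unfolding R_def using bdd that by (intro cInf_lower) auto
  have less_F: "\<exists>y>x. F y < a" if "R x < a" for x a
    using cInf_lessD[of "F ` {x<..}" a] that by (auto simp: R_def)
  have R_mono: "R x \<le> R y" if "x \<le> y" for x y
    using that order_trans[OF le_F[of x y] F_le[of y]] by (cases "x = y") auto
  have "(F \<longlongrightarrow> R x) (at_right x)" for x
  proof (rule order_tendstoI)
    fix a assume "a < R x"
    then show "\<forall>\<^sub>F y in at_right x. a < F y"
      using le_F eventually_at_right_less[of x] by (auto elim!: eventually_mono intro: less_le_trans)
  next
    fix a assume "R x < a"
    then obtain y where y: "x < y" "F y < a" using less_F by blast
    show "\<forall>\<^sub>F z in at_right x. F z < a"
      using eventually_at_right_real[OF y(1)]
    proof eventually_elim
      case (elim z)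
      then have "F z \<le> F y" by (intro F_mono) simp
      with y(2) show ?case by simp
    qed
  qed
  then have Lim_R: "(\<lambda>x. Lim (at_right x) F) = R"
    by (intro ext tendsto_Lim) auto
  have R_right: "continuous (at_right x) R" for x
    unfolding continuous_within
  proof (rule order_tendstoI)
    fix a assume "a < R x"
    then show "\<forall>\<^sub>F y in at_right x. a < R y"
      using R_mono eventually_at_right_less[of x]
      by (auto elim!: eventually_mono intro: less_le_trans)
  next
    fix a assume "R x < a"
    then obtain y where y: "x < y" "F y < a" using less_F by blast
    show "\<forall>\<^sub>F z in at_right x. R z < a"
      using eventually_at_right_real[OF y(1)]
      by eventually_elim (use y(2) le_F in \<open>auto intro: le_less_trans\<close>)
  qed
  \<comment> \<open>\<open>R x\<close> is caught between \<open>F x\<close> and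
    \<open>F (x + 1)\<close>.\<close>
  have R0: "(R \<longlongrightarrow> 0) at_bot"
  proof (rule tendsto_sandwich[OF _ _ F0])
    show "((\<lambda>x. F (x + 1)) \<longlongrightarrow> 0) at_bot"
      by (rule filterlim_compose[OF F0]) (auto simp: filterlim_at_bot eventually_at_bot_linorder algebra_simps intro: exI[of _ "_ - 1 :: real"])
  qed (auto simp: F_le le_F)
  have "emeasure (stieltjes_measure F) {..x} = ennreal (R x)" for x
  proof (rule LIMSEQ_unique)
    let ?M = "interval_measure R"
    have "(\<lambda>n. emeasure ?M {x - real n<..x}) \<longlonglongrightarrow> emeasure ?M (\<Union>n. {x - real n<..x})"
      by (rule Lim_emeasure_incseq) (auto simp: incseq_def)
    moreover have "(\<Union>n. {x - real n<..x}) = {..x}"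
    proof -
      have "\<exists>n. x - real n < y" for y
        using reals_Archimedean2[of "x - y"] by (auto simp: algebra_simps)
      then show ?thesis by auto
    qed
    ultimately show "(\<lambda>n. emeasure ?M {x - real n<..x}) \<longlonglongrightarrow> emeasure (stieltjes_measure F) {..x}"
      by (simp add: stieltjes_measure_def Lim_R)
    have "filterlim (\<lambda>n. x - real n) at_bot sequentially"
      by real_asymp
    then have "(\<lambda>n. ennreal (R x - R (x - real n))) \<longlonglongrightarrow> ennreal (R x - 0)"
      by (intro tendsto_ennrealI tendsto_intros filterlim_compose[OF R0])
    then show "(\<lambda>n. emeasure ?M {x - real n<..x}) \<longlonglongrightarrow> ennreal (R x)"
      by (simp add: emeasure_interval_measure_Ioc R_mono R_right)
  qed
  moreover have "R x \<ge> 0" for x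
    by (rule tendsto_upperbound[OF R0]) (auto simp: eventually_at_bot_linorder intro: R_mono)
  ultimately have measure_R: "measure (stieltjes_measure F) {..x} = R x" for x
    by (simp add: measure_def)
  show "F x \<le> measure (stieltjes_measure F) {..x}" by (simp add: measure_R F_le)
  show "measure (stieltjes_measure F) {..x} \<le> F y" if "x < y" by (simp add: measure_R le_F that)
qed

section \<open>Uniform convergence as convergence along a filter\<close>

text \<open>Here \<open>t\<close> moves along \<open>F\<close> while the point of \<open>A t\<close>
  is unrestricted. Uniform convergence over \<open>A t\<close> becomes an ordinary limit, to which
  the usual limit rules apply.\<close>

definition fibre_filter :: "'a filter \<Rightarrow> ('a \<Rightarrow> 'b set) \<Rightarrow> ('a \<times> 'b) filter" where
  "fibre_filter F A = inf (filtercomap fst F) (principal (SIGMA t:UNIV. A t))"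

lemma eventually_fibre_filter:
  "eventually P (fibre_filter F A) \<longleftrightarrow> (\<forall>\<^sub>F t in F. \<forall>x\<in>A t. P (t, x))"
  unfolding fibre_filter_def eventually_inf_principal eventually_filtercomap
  by (auto elim: eventually_mono)

lemma SUP_tendsto_0_imp_eventually:
  fixes f :: "'a \<Rightarrow> 'b \<Rightarrow> real"
  assumes "((\<lambda>t. SUP x\<in>A t. ereal \<bar>f t x\<bar>) \<longlongrightarrow> 0) F" and "e > 0"
  shows "\<forall>\<^sub>F t in F. \<forall>x\<in>A t. \<bar>f t x\<bar> < e"
proof -
  have "\<forall>\<^sub>F t in F. (SUP x\<in>A t. ereal \<bar>f t x\<bar>) < ereal e"
    using assms by (intro order_tendstoD(2)) auto
  then show ?thesis
    by eventually_elim (metis SUP_lessD less_ereal.simps(1))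
qed

lemma tendsto_fibre_filter_imp_SUP:
  fixes f :: "'a \<Rightarrow> 'b \<Rightarrow> real"
  assumes lim: "((\<lambda>(t, x). f t x) \<longlongrightarrow> l) (fibre_filter F A)" and ne: "\<And>t. A t \<noteq> {}"
  shows "((\<lambda>t. SUP x\<in>A t. ereal \<bar>f t x - l\<bar>) \<longlongrightarrow> 0) F"
proof (rule order_tendstoI)
  fix a :: ereal assume a: "a < 0"
  \<comment> \<open>Nonemptiness of \<open>A t\<close> matters here: in the extended reals the
    supremum of the empty set is minus infinity.\<close>
  show "\<forall>\<^sub>F t in F. a < (SUP x\<in>A t. ereal \<bar>f t x - l\<bar>)"
  proof (rule always_eventually, intro allI)
    fix t
    obtain x where "x \<in> A t" using ne[of t] by blast
    then have "0 \<le> (SUP x\<in>A t. ereal \<bar>f t x - l\<bar>)" by (intro SUP_upper2) auto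
    with a show "a < (SUP x\<in>A t. ereal \<bar>f t x - l\<bar>)" by (rule less_le_trans)
  qed
next
  fix a :: ereal assume "0 < a"
  then obtain e where e: "0 < ereal e" "ereal e < a" using ereal_dense2 by blast
  have "\<forall>\<^sub>F p in fibre_filter F A. dist (case p of (t, x) \<Rightarrow> f t x) l < e"
    using e by (intro tendstoD[OF lim]) simp
  then have "\<forall>\<^sub>F t in F. \<forall>x\<in>A t. \<bar>f t x - l\<bar> < e"
    by (simp add: eventually_fibre_filter dist_real_def)
  then show "\<forall>\<^sub>F t in F. (SUP x\<in>A t. ereal \<bar>f t x - l\<bar>) < a"
  proof eventually_elim
    case (elim t)
    then have "(SUP x\<in>A t. ereal \<bar>f t x - l\<bar>) \<le> ereal e" by (intro SUP_least) (auto intro: less_imp_le)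
    then show ?case using e(2) by (rule le_less_trans)
  qed
qed

section \<open>The uniform Tauberian theorem\<close>

theorem theorem1:
  fixes G L :: "real \<Rightarrow> real \<Rightarrow> real"
    and \<xi> s :: "real \<Rightarrow> real"
    and \<alpha> :: real
  assumes G_bv: "\<And>t. t \<ge> 0 \<Longrightarrow> locally_bounded_variation (G t)"
    and G_mono: "\<And>t. t \<ge> 0 \<Longrightarrow> mono (G t)"
    and G_lim: "\<And>t. t \<ge> 0 \<Longrightarrow> (G t \<longlongrightarrow> 0) at_bot"
    and xi_pos: "\<And>t. t \<ge> 0 \<Longrightarrow> \<xi> t > 0"
    and transform: "\<And>t u. t \<ge> 0 \<Longrightarrow> u \<in> {0<..<\<xi> t} \<Longrightarrow> laplace_stieltjes_exists (G t) u"
    and alpha: "\<alpha> \<ge> 0"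
    and L: "L \<in> class_L_plus \<alpha>"
    and s_pos: "\<And>t. t \<ge> 0 \<Longrightarrow> s t > 0"
    and s_small: "s \<in> o[at_top](\<xi>)"
    and s_lim: "(s \<longlongrightarrow> 0) at_top"
    and G_hat: "\<And>c. c > 0 \<Longrightarrow>
      ((\<lambda>t. SUP u\<in>{0<..c * s t}.
          ereal \<bar>laplace_stieltjes (G t) u / (Gamma (\<alpha> + 1) * L t (1 / u) * u powr (- \<alpha>)) - 1\<bar>)
        \<longlongrightarrow> 0) at_top"
  shows "((\<lambda>t. SUP x\<in>{1 / s t..}. ereal \<bar>G t x / (L t x * x powr \<alpha>) - 1\<bar>) \<longlongrightarrow> 0) at_top"
proof -
  \<comment> \<open>Along this filter both coordinates tend to infinity, since
    \<open>x \<ge> 1 / s t\<close> and \<open>s t\<close> tends to 0.\<close>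
  define \<Phi> where "\<Phi> = fibre_filter at_top (\<lambda>t. {1 / s t..})"
  have ev: "eventually P \<Phi> \<longleftrightarrow> (\<forall>\<^sub>F t in at_top. \<forall>x\<ge>1 / s t. P (t, x))" for P
    by (simp add: \<Phi>_def eventually_fibre_filter atLeast_def)
  have L_class: "L \<in> class_L" using L by (simp add: class_L_plus_def)
  obtain x0 t0 where x0: "x0 > 0" and L_pos: "\<forall>t\<ge>t0. \<forall>x\<ge>x0. L t x > 0"
    and L_unif: "\<forall>\<Lambda>>0. \<forall>\<eta>>0. \<exists>xb. \<exists>tb\<ge>t0. min xb (\<Lambda> * xb) \<ge> x0 \<and>
      (\<forall>t\<ge>tb. (SUP x\<in>{xb..}. ereal \<bar>L t (\<Lambda> * x) / L t x - 1\<bar>) < ereal \<eta>)"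
    using L_class unfolding class_L_def mem_Collect_eq by (elim conjE exE) (rule that)
  have t_large: "\<forall>\<^sub>F (t, x) in \<Phi>. t \<ge> T" for T
    unfolding ev using eventually_ge_at_top[of T] by eventually_elim simp
  have s_pos_ev: "\<forall>\<^sub>F t in at_top. s t > 0"
    using eventually_ge_at_top[of 0] by eventually_elim (rule s_pos)
  have x_large: "\<forall>\<^sub>F (t, x) in \<Phi>. x \<ge> X" for X
  proof -
    have "filterlim (\<lambda>t. inverse (s t)) at_top at_top"
      using s_lim s_pos_ev by (rule filterlim_inverse_at_top)
    then have "\<forall>\<^sub>F t in at_top. X \<le> inverse (s t)"
      by (simp add: filterlim_at_top)
    then show ?thesis
      unfolding ev by eventually_elim (auto simp: inverse_eq_divide)
  qed
  have L_pos_ev: "\<forall>\<^sub>F (t, x) in \<Phi>. L t (\<Lambda> * x) > 0" if "\<Lambda> > 0" for \<Lambda>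
    using t_large[of t0] x_large[of "x0 / \<Lambda>"]
  proof eventually_elim
    case (elim p)
    then show ?case using that L_pos by (auto simp: divide_le_eq mult.commute)
  qed
  have L_ratio: "((\<lambda>(t, x). L t (\<Lambda> * x) / L t x) \<longlongrightarrow> 1) \<Phi>" if \<Lambda>: "\<Lambda> > 0" for \<Lambda>
  proof (rule tendstoI)
    fix e :: real assume e: "e > 0"
    obtain xb tb where tb: "\<forall>t\<ge>tb. (SUP x\<in>{xb..}. ereal \<bar>L t (\<Lambda> * x) / L t x - 1\<bar>) < ereal e"
      using L_unif[rule_format, OF \<Lambda> e] by (elim exE conjE) (rule that)
    show "\<forall>\<^sub>F p in \<Phi>. dist (case p of (t, x) \<Rightarrow> L t (\<Lambda> * x) / L t x) 1 < e"
      using t_large[of tb] x_large[of xb]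
    proof eventually_elim
      case (elim p)
      obtain t x where p: "p = (t, x)" by fastforce
      have "ereal \<bar>L t (\<Lambda> * x) / L t x - 1\<bar> < ereal e"
        using elim by (intro SUP_lessD[OF tb[rule_format]]) (auto simp: p)
      then show ?case by (simp add: p dist_real_def)
    qed
  qed
  \<comment> \<open>For \<open>x \<ge> 1 / s t\<close> the point \<open>u = k / x\<close> lies in
    \<open>{0<..k * s t}\<close>, so the hypothesis on the transform applies with constant
    \<open>k\<close>. The form \<open>1 / (k / x)\<close> is kept to match it literally.\<close>
  have hat_ratio: "((\<lambda>(t, x). laplace_stieltjes (G t) (k / x) /
      (Gamma (\<alpha> + 1) * L t (1 / (k / x)) * (k / x) powr (- \<alpha>))) \<longlongrightarrow> 1) \<Phi>" if k: "k > 0" for k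
  proof (rule tendstoI)
    fix e :: real assume e: "e > 0"
    show "\<forall>\<^sub>F p in \<Phi>. dist (case p of (t, x) \<Rightarrow> laplace_stieltjes (G t) (k / x) /
        (Gamma (\<alpha> + 1) * L t (1 / (k / x)) * (k / x) powr (- \<alpha>))) 1 < e"
      unfolding ev using SUP_tendsto_0_imp_eventually[OF G_hat[OF k] e] s_pos_ev
    proof eventually_elim
      case (elim t)
      have "k / x \<in> {0<..k * s t}" if x: "x \<ge> 1 / s t" for x
      proof -
        have "0 < 1 / s t" using elim(2) by simp
        then have "x > 0" using x by linarith
        then show ?thesis using k x elim(2) by (auto simp: field_simps)
      qed
      with elim(1) show ?case by (simp only: dist_real_def prod.case) blast
    qed
  qed
  define M where "M p = stieltjes_measure (G (fst p))" for p :: "real \<times> real"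
  define c where "c p = L (fst p) (snd p) * snd p powr \<alpha>" for p :: "real \<times> real"
  have c_pos: "\<forall>\<^sub>F p in \<Phi>. 0 < c p"
    using L_pos_ev[OF zero_less_one] x_large[of 1] by eventually_elim (auto simp: c_def)
  have measure_lim: "((\<lambda>p. measure (M p) {..b / (1 / snd p)} / c p) \<longlongrightarrow> b powr \<alpha>) \<Phi>" if "b > 0" for b
  proof (rule karamata_tauberian_filter[OF alpha])
    show "sets (M p) = sets borel" for p
      by (simp add: M_def stieltjes_measure_def)
    show "\<forall>\<^sub>F p in \<Phi>. 0 < 1 / snd p"
      using x_large[of 1] by eventually_elim auto
    show "\<forall>\<^sub>F p in \<Phi>. integrable (M p) (\<lambda>y. exp (- (real (Suc k) * (1 / snd p) * y)))" for k
    proof -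
      \<comment> \<open>The factor \<open>2 * real (Suc k)\<close> puts the argument
        \<open>real (Suc k) / x\<close> at or below half of \<open>\<xi> t\<close>, hence strictly
        inside the interval where the transform exists.\<close>
      have "\<forall>\<^sub>F t in at_top. norm (s t) \<le> 1 / (2 * real (Suc k)) * norm (\<xi> t)"
        by (rule landau_o.smallD[OF s_small]) simp
      then have "\<forall>\<^sub>F (t, x) in \<Phi>. integrable (M (t, x)) (\<lambda>y. exp (- (real (Suc k) * (1 / x) * y)))"
        unfolding ev using eventually_ge_at_top[of 0]
      proof eventually_elim
        case (elim t)
        note st = s_pos[OF elim(2)] and xit = xi_pos[OF elim(2)]
        have "integrable (M (t, x)) (\<lambda>y. exp (- (real (Suc k) * (1 / x) * y)))" if x: "x \<ge> 1 / s t" for x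
        proof -
          have "0 < 1 / s t" using st by simp
          then have x_pos: "x > 0" using x by linarith
          then have "real (Suc k) * (1 / x) \<le> real (Suc k) * s t"
            using x st by (intro mult_left_mono) (auto simp: field_simps)
          also have "\<dots> \<le> real (Suc k) * (1 / (2 * real (Suc k)) * \<xi> t)"
            using elim(1) st xit by (intro mult_left_mono) auto
          also have "\<dots> = \<xi> t / 2" by (simp add: field_simps)
          also have "\<dots> < \<xi> t" using xit by simp
          finally have "real (Suc k) * (1 / x) \<in> {0<..<\<xi> t}" using x_pos by simp
          from transform[OF elim(2) this] show ?thesis
            by (simp add: laplace_stieltjes_exists_def M_def)
        qed
        then show ?case by auto
      qed
      then show ?thesis by (simp add: case_prod_beta')
    qed
    show "((\<lambda>p. (LINT y|M p. exp (- (real (Suc k) * (1 / snd p) * y))) / c p)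
        \<longlongrightarrow> Gamma (\<alpha> + 1) * real (Suc k) powr - \<alpha>) \<Phi>" for k
    proof -
      define K where "K = real (Suc k)"
      have K: "K > 0" by (simp add: K_def)
      \<comment> \<open>The normalised transform at \<open>K / x\<close> is split into three
        factors: its ratio to the assumed asymptotics, the ratio of \<open>L t (x / K)\<close> to
        \<open>L t x\<close>, which slow variation sends to 1, and the constant that remains in the
        limit.\<close>
      have "((\<lambda>p. (case p of (t, x) \<Rightarrow> laplace_stieltjes (G t) (K / x) /
            (Gamma (\<alpha> + 1) * L t (1 / (K / x)) * (K / x) powr (- \<alpha>))) *
          (case p of (t, x) \<Rightarrow> L t (1 / K * x) / L t x) * (Gamma (\<alpha> + 1) * K powr - \<alpha>))
        \<longlongrightarrow> 1 * 1 * (Gamma (\<alpha> + 1) * K powr - \<alpha>)) \<Phi>"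
        using K by (intro tendsto_intros hat_ratio L_ratio) auto
      then have "((\<lambda>p. (LINT y|M p. exp (- (K * (1 / snd p) * y))) / c p)
        \<longlongrightarrow> 1 * 1 * (Gamma (\<alpha> + 1) * K powr - \<alpha>)) \<Phi>"
      proof (rule Lim_transform_eventually)
        show "\<forall>\<^sub>F p in \<Phi>. (case p of (t, x) \<Rightarrow> laplace_stieltjes (G t) (K / x) /
            (Gamma (\<alpha> + 1) * L t (1 / (K / x)) * (K / x) powr (- \<alpha>))) *
          (case p of (t, x) \<Rightarrow> L t (1 / K * x) / L t x) * (Gamma (\<alpha> + 1) * K powr - \<alpha>) =
          (LINT y|M p. exp (- (K * (1 / snd p) * y))) / c p"
          using L_pos_ev[OF divide_pos_pos[OF zero_less_one K]] L_pos_ev[OF zero_less_one] x_large[of 1]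
        proof eventually_elim
          case (elim p)
          obtain t x where p: "p = (t, x)" by fastforce
          have pos: "L t (x / K) > 0" "L t x > 0" "x > 0" using elim by (auto simp: p)
          have "(LINT y|M p. exp (- (K * (1 / snd p) * y))) = laplace_stieltjes (G t) (K / x)"
            by (simp add: laplace_stieltjes_def M_def p)
          moreover have "(K / x) powr (- \<alpha>) = K powr (- \<alpha>) * x powr \<alpha>"
            using K pos by (simp add: powr_divide powr_minus field_simps)
          moreover have "Gamma (\<alpha> + 1) > 0" using alpha by (intro Gamma_real_pos) simp
          ultimately show ?case using pos K by (simp add: p c_def field_simps)
        qed
      qed
      then show ?thesis by (simp add: K_def)
    qed
  qed (use that c_pos in auto)
  have "((\<lambda>(t, x). G t x / (L t x * x powr \<alpha>)) \<longlongrightarrow> 1) \<Phi>"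
  proof (rule order_tendstoI)
    fix a :: real assume a: "a < 1"
    \<comment> \<open>At \<open>b = 1\<close> the measure of \<open>{..x}\<close> may exceed
      \<open>G t x\<close> by a jump. A \<open>b\<close> strictly below 1 avoids this, as
      \<open>b * x < x\<close>, and costs only the factor \<open>b powr \<alpha>\<close>, which is
      close to 1.\<close>
    have "((\<lambda>b. b powr \<alpha>) \<longlongrightarrow> 1 powr \<alpha>) (at_left 1)"
      by (intro tendsto_intros) auto
    then have "\<forall>\<^sub>F b in at_left 1. a < b powr \<alpha> \<and> b \<in> {0<..<1}"
      using a eventually_at_left_real[of 0 "1 :: real"]
      by (intro eventually_conj) (auto dest: order_tendstoD)
    then obtain b where b: "a < b powr \<alpha>" "0 < b" "b < 1"
      using eventually_happens'[OF trivial_limit_at_left_real] by auto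
    from order_tendstoD(1)[OF measure_lim[OF b(2)] b(1)] c_pos x_large[of 1] t_large[of 0]
    show "\<forall>\<^sub>F p in \<Phi>. a < (case p of (t, x) \<Rightarrow> G t x / (L t x * x powr \<alpha>))"
    proof eventually_elim
      case (elim p)
      obtain t x where p: "p = (t, x)" by fastforce
      have "t \<ge> 0" "b * x < x" using elim(3,4) b(3) by (auto simp: p)
      then have "measure (M p) {..b * x} \<le> G t x"
        unfolding M_def p by (simp add: stieltjes_measure_bounds(2) G_mono G_lim)
      then have "measure (M p) {..b * x} / c p \<le> G t x / c p"
        using elim(2) by (intro divide_right_mono) auto
      then show ?case using elim(1) by (simp add: p c_def)
    qed
  next
    fix a :: real assume a: "1 < a"
    have "((\<lambda>p. measure (M p) {..1 / (1 / snd p)} / c p) \<longlongrightarrow> 1) \<Phi>"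
      using measure_lim[of 1] by simp
    from order_tendstoD(2)[OF this a] c_pos t_large[of 0]
    show "\<forall>\<^sub>F p in \<Phi>. (case p of (t, x) \<Rightarrow> G t x / (L t x * x powr \<alpha>)) < a"
    proof eventually_elim
      case (elim p)
      obtain t x where p: "p = (t, x)" by fastforce
      have "t \<ge> 0" using elim(3) by (simp add: p)
      then have "G t x \<le> measure (M p) {..x}"
        unfolding M_def p by (simp add: stieltjes_measure_bounds(1) G_mono G_lim)
      then have "G t x / c p \<le> measure (M p) {..x} / c p"
        using elim(2) by (intro divide_right_mono) auto
      then show ?case using elim(1) by (simp add: p c_def)
    qed
  qed
  then show ?thesis
    unfolding \<Phi>_def by (rule tendsto_fibre_filter_imp_SUP) auto
qed

end
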